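(* Let $S,T \in GL_2(\mathbb{Z})$. If the infinite graph $G^{S^{\top},T^{\top}}$ has positive Cheeger constant, then $\{G_n^{S,T}\}_{n\ge 2}$ is a family of expander graphs.
   Context: $A^{\top}$ denotes the transpose of a matrix $A$. For $S,T\in GL_2(\mathbb{Z})$ (invertible integral $2\times 2$ matrices with integral inverse) and $n\ge 2$, $G_n^{S,T}=(V_n,E_n^{S,T})$ is the undirected graph with vertex set $V_n=(\mathbb{Z}/n\mathbb{Z})^2$ in which every $(x,y)\in V_n$ is joined by an edge to each of $(x\pm1,y)$, $(x,y\pm1)$, $S(x,y)$, $S^{-1}(x,y)$, $T(x,y)$, $T^{-1}(x,y)$ (arithmetic modulo $n$). For $S,T \in GL_2(\mathbb{Z})$, $G^{S,T}$ is the infinite undirected graph with vertex set $\mathbb{Z}^2\setminus\{0\}$ and edge set $\{\{z,Sz\},\{z,Tz\}: z\in\mathbb{Z}^2\setminus\{0\}\}$. An infinite graph $G=(V,E)$ with uniformly bounded degrees has positive Cheeger constant if there is $\varepsilon>0$ such that every finite $U\subseteq V$ has at least $\varepsilon|U|$ edges with exactly one endpoint in $U$. For a finite graph $G=(V,E)$, $\lambda_2(G)$ is the minimum of $\frac{\sum_{\{u,v\}\in E}|f(u)-f(v)|^2}{\sum_{u\in V}|f(u)|^2}$ over nonzero $f:V\to\mathbb{C}$ with $\sum_{u\in V}f(u)=0$. An infinite family $\{G_n\}$ of finite graphs with uniformly bounded degrees is an expander family (family of expander graphs) if there is a constant $c>0$ with $\lambda_2(G_n)\ge c$ for all $n$.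 *)

theory Defs
  imports "HOL-Analysis.Analysis"
begin

text \<open>
  An undirected graph is a pair of a vertex set and an edge set; the edge joining
  \<open>u\<close> and \<open>v\<close> is the set \<open>{u, v}\<close>.  Loops \<open>{u, u} = {u}\<close> are permitted (they arise
  from fixed points of the matrices), multiple edges are not.
\<close>

type_synonym 'a ugraph = "'a set \<times> 'a set set"

abbreviation verts :: "'a ugraph \<Rightarrow> 'a set" where "verts \<equiv> fst"
abbreviation edges :: "'a ugraph \<Rightarrow> 'a set set" where "edges \<equiv> snd"

definition is_ugraph :: "'a ugraph \<Rightarrow> bool" where
  "is_ugraph G \<longleftrightarrow> (\<forall>e \<in> edges G. \<exists>u \<in> verts G. \<exists>v \<in> verts G. e = {u, v})"

definition degrees_bounded_by :: "nat \<Rightarrow> 'a ugraph \<Rightarrow> bool" where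
  "degrees_bounded_by d G \<longleftrightarrow>
     (\<forall>v \<in> verts G. finite {e \<in> edges G. v \<in> e} \<and> card {e \<in> edges G. v \<in> e} \<le> d)"

text \<open>Both endpoints of a loop coincide, so a loop is never a boundary edge.\<close>

definition edge_boundary :: "'a ugraph \<Rightarrow> 'a set \<Rightarrow> 'a set set" where
  "edge_boundary G U = {e \<in> edges G. \<exists>u v. e = {u, v} \<and> u \<in> U \<and> v \<notin> U}"

definition positive_cheeger_constant :: "'a ugraph \<Rightarrow> bool" where
  "positive_cheeger_constant G \<longleftrightarrow>
     is_ugraph G \<and> infinite (verts G) \<and> (\<exists>d. degrees_bounded_by d G) \<and>
     (\<exists>\<epsilon>::real. \<epsilon> > 0 \<and>
        (\<forall>U. finite U \<and> U \<subseteq> verts G \<longrightarrow>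
           real (card (edge_boundary G U)) \<ge> \<epsilon> * real (card U)))"

definition edge_energy :: "('a \<Rightarrow> complex) \<Rightarrow> 'a set \<Rightarrow> real" where
  "edge_energy f e = (THE r. \<exists>u v. e = {u, v} \<and> r = (cmod (f u - f v))\<^sup>2)"

lemma edge_energy_doubleton: "edge_energy f {u, v} = (cmod (f u - f v))\<^sup>2"
  unfolding edge_energy_def
  by (rule the_equality) (auto simp: doubleton_eq_iff norm_minus_commute)

text \<open>
  For a finite graph with at least two vertices the set below is nonempty and has
  a least element, so its infimum is the minimum.  Only the values of \<open>f\<close> on the
  vertex set matter.
\<close>

definition lambda2 :: "'a ugraph \<Rightarrow> real" where
  "lambda2 G =
     Inf {(\<Sum>e \<in> edges G. edge_energy f e) / (\<Sum>u \<in> verts G. (cmod (f u))\<^sup>2) | f.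
            (\<exists>u \<in> verts G. f u \<noteq> 0) \<and> (\<Sum>u \<in> verts G. f u) = 0}"

definition expander_family :: "'i set \<Rightarrow> ('i \<Rightarrow> 'a ugraph) \<Rightarrow> bool" where
  "expander_family I G \<longleftrightarrow>
     infinite I \<and>
     (\<forall>i \<in> I. is_ugraph (G i) \<and> finite (verts (G i))) \<and>
     (\<exists>d. \<forall>i \<in> I. degrees_bounded_by d (G i)) \<and>
     (\<exists>c::real. c > 0 \<and> (\<forall>i \<in> I. lambda2 (G i) \<ge> c))"

text \<open>
  \<open>(\<int>/n\<int>)\<^sup>2\<close> is represented by the vectors with entries in \<open>{0..<n}\<close>, with
  arithmetic followed by entrywise reduction modulo \<open>n\<close>.  Membership of a matrix in
  \<open>GL\<^sub>2(\<int>)\<close> is \<^const>\<open>invertible\<close> at type \<^typ>\<open>int^2^2\<close>.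
\<close>

definition torus_verts :: "nat \<Rightarrow> (int^2) set" where
  "torus_verts n = {z. \<forall>i. 0 \<le> z $ i \<and> z $ i < int n}"

definition reduce_mod :: "nat \<Rightarrow> int^2 \<Rightarrow> int^2" where
  "reduce_mod n z = (\<chi> i. z $ i mod int n)"

definition torus_neighbours :: "int^2^2 \<Rightarrow> int^2^2 \<Rightarrow> nat \<Rightarrow> int^2 \<Rightarrow> (int^2) set" where
  "torus_neighbours S T n z = reduce_mod n `
     {z + vector [1, 0], z - vector [1, 0], z + vector [0, 1], z - vector [0, 1],
      S *v z, matrix_inv S *v z, T *v z, matrix_inv T *v z}"

definition torus_graph :: "int^2^2 \<Rightarrow> int^2^2 \<Rightarrow> nat \<Rightarrow> (int^2) ugraph" where
  "torus_graph S T n =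
     (torus_verts n, {{z, w} | z w. z \<in> torus_verts n \<and> w \<in> torus_neighbours S T n z})"

definition lattice_graph :: "int^2^2 \<Rightarrow> int^2^2 \<Rightarrow> (int^2) ugraph" where
  "lattice_graph S T =
     (- {0}, {{z, S *v z} | z. z \<noteq> 0} \<union> {{z, T *v z} | z. z \<noteq> 0})"

end

theory Submission
  imports Defs
begin

text \<open>
  Extend \<open>f\<close> periodically to \<open>\<int>\<^sup>2\<close> and let \<open>F\<close> be its Fourier transform, again a periodic function.
  By Parseval, the energy of \<open>f\<close> along \<open>S\<close> becomes the energy of \<open>F\<close> along \<open>S\<^sup>T\<close>, and the energy along
  the unit shifts becomes \<open>\<Sum>W |F|\<^sup>2\<close> with a weight \<open>W\<close> vanishing only at \<open>0\<close>. So if the total energy is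
  small, \<open>F\<close> is concentrated on frequencies \<open>k\<close> with all entries below a small multiple of \<open>n\<close>. There the
  torus is indistinguishable from \<open>\<int>\<^sup>2\<close>, and \<open>F 0 = 0\<close>, so \<open>|F|\<^sup>2\<close>, cut off to small frequencies, is a
  finitely supported function on \<open>\<int>\<^sup>2 - {0}\<close>. The Cheeger inequality there bounds its sum by its total
  variation, which is controlled by the energy of \<open>F\<close> through the weighted AM-GM inequality.
\<close>

section \<open>Periodic functions\<close>

text \<open>The pairing stays in \<open>int\<close>, so that a character value being 1 can be read
  off as divisibility by \<open>n\<close>.\<close>

definition dot :: "int^2 \<Rightarrow> int^2 \<Rightarrow> int" where
  "dot k z = (\<Sum>i\<in>UNIV. k $ i * z $ i)"

text \<open>Functions on the torus are encoded as functions on all of \<open>int^2\<close> that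
  factor through reduction, so that matrices and shifts act on arguments without reducing each
  time.\<close>

definition periodic :: "nat \<Rightarrow> (int^2 \<Rightarrow> 'a) \<Rightarrow> bool" where
  "periodic n p \<longleftrightarrow> (\<forall>z. p (reduce_mod n z) = p z)"

lemma periodicD: "periodic n p \<Longrightarrow> p (reduce_mod n z) = p z"
  by (simp add: periodic_def)

lemma periodic_cong: "periodic n p \<Longrightarrow> reduce_mod n z = reduce_mod n w \<Longrightarrow> p z = p w"
  by (metis periodicD)

lemma reduce_mod_eq_iff: "reduce_mod n z = reduce_mod n w \<longleftrightarrow> (\<forall>i. z $ i mod int n = w $ i mod int n)"
  by (simp add: reduce_mod_def vec_eq_iff)

lemma reduce_mod_reduce_mod [simp]: "reduce_mod n (reduce_mod n z) = reduce_mod n z"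
  by (simp add: reduce_mod_def vec_eq_iff)

lemma reduce_mod_in_verts [simp]: "n > 0 \<Longrightarrow> reduce_mod n z \<in> torus_verts n"
  by (simp add: reduce_mod_def torus_verts_def)

lemma reduce_mod_id: "z \<in> torus_verts n \<Longrightarrow> reduce_mod n z = z"
  by (auto simp: reduce_mod_def torus_verts_def vec_eq_iff)

lemma reduce_mod_add_left: "reduce_mod n (reduce_mod n z + w) = reduce_mod n (z + w)"
  by (simp add: reduce_mod_def vec_eq_iff mod_simps)

lemma reduce_mod_matrix: "reduce_mod n (A *v reduce_mod n z) = reduce_mod n (A *v z)"
proof -
  have "(\<Sum>j\<in>UNIV. A$i$j * (z$j mod int n)) mod int n = (\<Sum>j\<in>UNIV. A$i$j * z$j) mod int n" for i
    by (subst (1 2) mod_sum_eq [symmetric]) (simp add: mod_simps)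
  then show ?thesis by (simp add: reduce_mod_def vec_eq_iff matrix_vector_mult_def)
qed

lemma finite_torus_verts [simp]: "finite (torus_verts n)"
proof (rule finite_subset)
  show "torus_verts n \<subseteq> (\<lambda>(a, b). vector [a, b]) ` ({0..<int n} \<times> {0..<int n})"
  proof
    fix z assume "z \<in> torus_verts n"
    then have "z = (\<lambda>(a, b). vector [a, b]) (z $ 1, z $ 2)" "(z $ 1, z $ 2) \<in> {0..<int n} \<times> {0..<int n}"
      by (auto simp: torus_verts_def vec_eq_iff forall_2)
    then show "z \<in> (\<lambda>(a, b). vector [a, b]) ` ({0..<int n} \<times> {0..<int n})" by (rule image_eqI)
  qed
qed simp

lemma bij_betw_torus:
  assumes "n > 0"
    and "\<And>z. reduce_mod n (\<phi> (reduce_mod n z)) = reduce_mod n (\<phi> z)"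
    and "\<And>z. reduce_mod n (\<psi> (reduce_mod n z)) = reduce_mod n (\<psi> z)"
    and "\<And>z. \<psi> (\<phi> z) = z" "\<And>z. \<phi> (\<psi> z) = z"
  shows "bij_betw (\<lambda>z. reduce_mod n (\<phi> z)) (torus_verts n) (torus_verts n)"
  by (rule bij_betwI [where g = "\<lambda>z. reduce_mod n (\<psi> z)"]) (auto simp: assms reduce_mod_id)

lemma sum_torus_reindex:
  assumes "periodic n p" "n > 0"
    and "\<And>z. reduce_mod n (\<phi> (reduce_mod n z)) = reduce_mod n (\<phi> z)"
    and "\<And>z. reduce_mod n (\<psi> (reduce_mod n z)) = reduce_mod n (\<psi> z)"
    and "\<And>z. \<psi> (\<phi> z) = z" "\<And>z. \<phi> (\<psi> z) = z"
  shows "(\<Sum>z\<in>torus_verts n. p (\<phi> z)) = (\<Sum>z\<in>torus_verts n. p z)"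
proof -
  have "(\<Sum>z\<in>torus_verts n. p (reduce_mod n (\<phi> z))) = (\<Sum>z\<in>torus_verts n. p z)"
    using bij_betw_torus [OF assms(2-6)] by (rule sum.reindex_bij_betw)
  then show ?thesis by (simp add: periodicD [OF assms(1)])
qed

lemma sum_torus_matrix:
  assumes "periodic n p" "n > 0" "A ** A' = mat 1" "A' ** A = mat 1"
  shows "(\<Sum>z\<in>torus_verts n. p (A *v z)) = (\<Sum>z\<in>torus_verts n. p z)"
  using assms by (intro sum_torus_reindex [where \<psi> = "\<lambda>z. A' *v z"])
    (simp_all add: reduce_mod_matrix matrix_vector_mul_assoc)

lemma sum_torus_shift:
  assumes "periodic n p" "n > 0"
  shows "(\<Sum>z\<in>torus_verts n. p (z + a)) = (\<Sum>z\<in>torus_verts n. p z)"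
  \<comment> \<open>The inverse is written \<open>z + - a\<close> so that
    \<open>reduce_mod_add_left\<close> matches before simplification turns it into a
    difference.\<close>
  using assms by (intro sum_torus_reindex [where \<psi> = "\<lambda>z. z + - a"])
    (simp_all only: reduce_mod_add_left, simp_all)

text \<open>\<open>K\<close> may lie outside \<open>torus_verts n\<close>: moving each point to its
  representative preserves \<open>p\<close>, and injectivity prevents double counting.\<close>

lemma sum_le_sum_torus:
  fixes p :: "int^2 \<Rightarrow> real"
  assumes "periodic n p" "n > 0" "\<And>z. p z \<ge> 0" "inj_on (reduce_mod n) K"
  shows "(\<Sum>z\<in>K. p z) \<le> (\<Sum>z\<in>torus_verts n. p z)"
proof -
  have "(\<Sum>z\<in>K. p z) = (\<Sum>z\<in>reduce_mod n ` K. p z)"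
    by (simp add: sum.reindex assms periodicD [OF assms(1)])
  also have "\<dots> \<le> (\<Sum>z\<in>torus_verts n. p z)"
    by (rule sum_mono2) (auto simp: assms)
  finally show ?thesis .
qed

section \<open>Fourier transform on the torus\<close>

definition character :: "nat \<Rightarrow> int^2 \<Rightarrow> int^2 \<Rightarrow> complex" where
  "character n k z = cis (2 * pi * real_of_int (dot k z) / real n)"

lemma dot_commute: "dot k z = dot z k"
  by (simp add: dot_def mult.commute)

lemma dot_add_right: "dot k (z + w) = dot k z + dot k w"
  by (simp add: dot_def sum.distrib distrib_left)

lemma dot_minus_right: "dot k (- z) = - dot k z"
  by (simp add: dot_def sum_negf)

lemma dot_axis: "dot k (axis i 1) = k $ i"
  by (simp add: dot_def axis_def if_distrib cong: if_cong)

lemma dot_transpose: "dot (transpose A *v k) z = dot k (A *v z)"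
proof -
  have "dot (transpose A *v k) z = (\<Sum>i\<in>UNIV. \<Sum>j\<in>UNIV. A $ j $ i * k $ j * z $ i)"
    by (simp add: dot_def matrix_vector_mult_def transpose_def sum_distrib_right)
  also have "\<dots> = (\<Sum>j\<in>UNIV. \<Sum>i\<in>UNIV. A $ j $ i * k $ j * z $ i)"
    by (rule sum.swap)
  also have "\<dots> = dot k (A *v z)"
    by (simp add: dot_def matrix_vector_mult_def sum_distrib_left algebra_simps)
  finally show ?thesis .
qed

lemma character_commute: "character n k z = character n z k"
  by (simp add: character_def dot_commute)

lemma character_add: "character n k (z + w) = character n k z * character n k w"
  by (simp add: character_def dot_add_right cis_mult ring_distribs add_divide_distrib)

lemma character_minus: "character n k (- z) = cnj (character n k z)"
  by (simp add: character_def dot_minus_right cis_cnj)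

lemma character_diff: "character n k (z - w) = character n k z * cnj (character n k w)"
  using character_add [of n k z "- w"] by (simp add: character_minus)

lemma cis_eq_1_iff_dvd:
  assumes "n > 0"
  shows "cis (2 * pi * real_of_int a / real n) = 1 \<longleftrightarrow> int n dvd a"
proof
  assume "int n dvd a"
  then obtain m where "a = int n * m" by blast
  then have "2 * pi * real_of_int a / real n = 2 * pi * of_int m" using assms by simp
  then show "cis (2 * pi * real_of_int a / real n) = 1" using cis_multiple_2pi by simp
next
  assume "cis (2 * pi * real_of_int a / real n) = 1"
  then have "cos (2 * pi * real_of_int a / real n) = 1" by (metis Re_complex_of_real cis.sel(1) of_real_1)
  then obtain m :: int where "2 * pi * real_of_int a / real n = of_int m * 2 * pi"
    unfolding cos_one_2pi_int by blast
  then have "real_of_int a = real_of_int (m * int n)" using assms by (simp add: field_simps)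
  then show "int n dvd a" by (metis dvd_triv_right of_int_eq_iff)
qed

lemma periodic_character: "n > 0 \<Longrightarrow> periodic n (character n k)"
proof -
  assume n: "n > 0"
  have "character n k (reduce_mod n z) = character n k z" for z
  proof -
    have z: "z = reduce_mod n z + (\<chi> i. int n * (z $ i div int n))"
      by (simp add: reduce_mod_def vec_eq_iff)
    have "int n dvd dot k (\<chi> i. int n * (z $ i div int n))"
      by (auto simp: dot_def intro!: dvd_sum)
    then have "character n k (\<chi> i. int n * (z $ i div int n)) = 1"
      unfolding character_def by (simp only: cis_eq_1_iff_dvd [OF n])
    then show ?thesis by (subst (2) z) (simp add: character_add)
  qed
  then show ?thesis by (simp add: periodic_def)
qed

text \<open>Some entry of \<open>k\<close> is not divisible by \<open>n\<close>. Translation by that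
  unit vector preserves the sum but also multiplies it by a number other than 1.\<close>

lemma sum_character:
  assumes n: "n > 0" and k: "reduce_mod n k \<noteq> 0"
  shows "(\<Sum>z\<in>torus_verts n. character n k z) = 0"
proof -
  obtain i where "\<not> int n dvd k $ i"
    using k by (auto simp: reduce_mod_def vec_eq_iff dvd_eq_mod_eq_0)
  then have 1: "character n k (axis i 1) \<noteq> 1"
    by (simp add: character_def dot_axis cis_eq_1_iff_dvd [OF n])
  have "(\<Sum>z\<in>torus_verts n. character n k z) = (\<Sum>z\<in>torus_verts n. character n k (z + axis i 1))"
    using sum_torus_shift [OF periodic_character [OF n] n] by simp
  also have "\<dots> = (\<Sum>z\<in>torus_verts n. character n k z) * character n k (axis i 1)"
    by (simp add: character_add sum_distrib_right)
  finally show ?thesis using 1 by simp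
qed

text \<open>Unnormalised, and with the unconjugated character as kernel: hence the factor
  \<open>card (torus_verts n)\<close> in Parseval and the conjugate in
  \<open>dft_shift\<close>.\<close>

definition dft :: "nat \<Rightarrow> (int^2 \<Rightarrow> complex) \<Rightarrow> int^2 \<Rightarrow> complex" where
  "dft n f k = (\<Sum>z\<in>torus_verts n. f z * character n k z)"

lemma periodic_dft: "n > 0 \<Longrightarrow> periodic n (dft n f)"
  using periodicD [OF periodic_character]
  by (simp add: dft_def periodic_def character_commute [of n _ z for z])

lemma dft_diff: "dft n (\<lambda>z. f z - g z) k = dft n f k - dft n g k"
  by (simp add: dft_def sum_subtractf left_diff_distrib)

lemma dft_0: "dft n f 0 = (\<Sum>z\<in>torus_verts n. f z)"
  by (simp add: dft_def character_def dot_def)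

text \<open>Expanding the square gives a triple sum; summing over \<open>k\<close> first,
  orthogonality of characters leaves only the terms with \<open>z = w\<close>.\<close>

lemma parseval:
  assumes n: "n > 0"
  shows "(\<Sum>k\<in>torus_verts n. (cmod (dft n f k))\<^sup>2) =
     real (card (torus_verts n)) * (\<Sum>z\<in>torus_verts n. (cmod (f z))\<^sup>2)"
proof -
  let ?V = "torus_verts n"
  have orth: "(\<Sum>k\<in>?V. character n k (z - w)) = (if z = w then of_nat (card ?V) else 0)"
    if "z \<in> ?V" "w \<in> ?V" for z w
  proof (cases "z = w")
    case True
    then show ?thesis by (simp add: character_def dot_def)
  next
    case False
    have "reduce_mod n (z - w) \<noteq> 0"
    proof
      assume 0: "reduce_mod n (z - w) = 0"
      have "reduce_mod n z = reduce_mod n (reduce_mod n (z - w) + w)"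
        by (simp add: reduce_mod_add_left)
      then show False using 0 False that by (simp add: reduce_mod_id)
    qed
    then show ?thesis using sum_character [OF n] False
      by (simp add: character_commute [of n _ "z - w"])
  qed
  have "complex_of_real (\<Sum>k\<in>?V. (cmod (dft n f k))\<^sup>2) =
      (\<Sum>k\<in>?V. \<Sum>z\<in>?V. \<Sum>w\<in>?V. f z * cnj (f w) * character n k (z - w))"
    by (simp add: complex_norm_square dft_def sum_product character_diff mult_ac
        del: of_real_power)
  also have "\<dots> = (\<Sum>z\<in>?V. \<Sum>w\<in>?V. f z * cnj (f w) * (\<Sum>k\<in>?V. character n k (z - w)))"
    by (subst sum.swap, rule sum.cong, simp, subst sum.swap) (simp add: sum_distrib_left)
  also have "\<dots> = (\<Sum>z\<in>?V. \<Sum>w\<in>?V. if z = w then f z * cnj (f w) * of_nat (card ?V) else 0)"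
    by (intro sum.cong refl) (simp add: orth)
  also have "\<dots> = (\<Sum>z\<in>?V. f z * cnj (f z) * of_nat (card ?V))"
    by simp
  also have "\<dots> = complex_of_real (real (card ?V) * (\<Sum>z\<in>?V. (cmod (f z))\<^sup>2))"
    by (simp add: complex_norm_square sum_distrib_left mult_ac del: of_real_power)
  finally show ?thesis by (simp only: of_real_eq_iff)
qed

text \<open>Substituting \<open>A *v z\<close> for \<open>z\<close> permutes the torus, and the
  pairing then moves \<open>A\<close> onto the frequency as its transpose. This is the source of the
  transposes in the theorem.\<close>

lemma dft_matrix:
  assumes f: "periodic n f" and n: "n > 0" and A: "A ** A' = mat 1" "A' ** A = mat 1"
  shows "dft n (\<lambda>z. f (A' *v z)) k = dft n f (transpose A *v k)"
proof -
  let ?p = "\<lambda>z. f (A' *v z) * character n k z"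
  have "periodic n ?p"
    unfolding periodic_def
    using periodicD [OF periodic_character [OF n]] periodic_cong [OF f reduce_mod_matrix] by simp
  then have "dft n (\<lambda>z. f (A' *v z)) k = (\<Sum>z\<in>torus_verts n. ?p (A *v z))"
    unfolding dft_def by (rule sum_torus_matrix [OF _ n A, symmetric])
  also have "\<dots> = dft n f (transpose A *v k)"
    by (simp add: dft_def character_def dot_transpose matrix_vector_mul_assoc A del: transpose_matrix_vector)
  finally show ?thesis .
qed

lemma dft_shift:
  assumes f: "periodic n f" and n: "n > 0"
  shows "dft n (\<lambda>z. f (z + a)) k = dft n f k * cnj (character n k a)"
proof -
  \<comment> \<open>The backward shift sits in the character, so that \<open>?p (z + a)\<close> is
    the summand of the transform of the shifted function.\<close>
  let ?p = "\<lambda>z. f z * character n k (z + - a)"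
  have "character n k (reduce_mod n z + - a) = character n k (z + - a)" for z
    by (rule periodic_cong [OF periodic_character [OF n] reduce_mod_add_left])
  then have "periodic n ?p"
    unfolding periodic_def using periodicD [OF f] by simp
  then have "(\<Sum>z\<in>torus_verts n. ?p (z + a)) = (\<Sum>z\<in>torus_verts n. ?p z)"
    by (rule sum_torus_shift [OF _ n])
  then show ?thesis
    by (simp add: dft_def character_diff sum_distrib_right mult.assoc)
qed

text \<open>The Fourier multiplier of the discrete Laplacian: each summand is the squared modulus of
  1 minus a root of unity.\<close>

definition freq_weight :: "nat \<Rightarrow> int^2 \<Rightarrow> real" where
  "freq_weight n k = (\<Sum>i\<in>UNIV. 2 - 2 * cos (2 * pi * real_of_int (k $ i) / real n))"

lemma norm_1_minus_cis: "(cmod (1 - cis t))\<^sup>2 = 2 - 2 * cos t"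
proof -
  have "(cmod (1 - cis t))\<^sup>2 = 1 - 2 * cos t + ((sin t)\<^sup>2 + (cos t)\<^sup>2)"
    by (simp only: cmod_power2) (simp add: power2_eq_square algebra_simps)
  then show ?thesis by simp
qed

lemma freq_weight_character:
  "freq_weight n k = (\<Sum>i\<in>UNIV. (cmod (1 - cnj (character n k (axis i 1))))\<^sup>2)"
  by (simp add: freq_weight_def character_def dot_axis cis_cnj norm_1_minus_cis)

lemma freq_weight_nonneg: "freq_weight n k \<ge> 0"
  by (simp add: freq_weight_character sum_nonneg)

lemma periodic_freq_weight: "n > 0 \<Longrightarrow> periodic n (freq_weight n)"
  using periodicD [OF periodic_character, of n "axis i 1" for i]
  by (simp add: periodic_def freq_weight_character character_commute [of n _ "axis i 1" for i])

lemma matrix_energy: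
  assumes "periodic n f" "n > 0" "A ** A' = mat 1" "A' ** A = mat 1"
  shows "(\<Sum>k\<in>torus_verts n. (cmod (dft n f k - dft n f (transpose A *v k)))\<^sup>2) =
    real (card (torus_verts n)) * (\<Sum>z\<in>torus_verts n. (cmod (f z - f (A' *v z)))\<^sup>2)"
  using parseval [OF \<open>n > 0\<close>, of "\<lambda>z. f z - f (A' *v z)"]
  by (simp add: dft_diff dft_matrix [OF assms])

lemma shift_energy:
  assumes "periodic n f" "n > 0"
  shows "(\<Sum>k\<in>torus_verts n. freq_weight n k * (cmod (dft n f k))\<^sup>2) =
    real (card (torus_verts n)) * (\<Sum>i\<in>UNIV. \<Sum>z\<in>torus_verts n. (cmod (f z - f (z + axis i 1)))\<^sup>2)"
proof -
  have "(\<Sum>k\<in>torus_verts n. freq_weight n k * (cmod (dft n f k))\<^sup>2) =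
    (\<Sum>k\<in>torus_verts n. \<Sum>i\<in>UNIV. (cmod (dft n (\<lambda>z. f z - f (z + axis i 1)) k))\<^sup>2)"
    by (simp add: freq_weight_character sum_distrib_right dft_diff dft_shift [OF assms] flip: power_mult_distrib norm_mult)
      (simp add: algebra_simps)
  also have "\<dots> = (\<Sum>i\<in>UNIV. \<Sum>k\<in>torus_verts n. (cmod (dft n (\<lambda>z. f z - f (z + axis i 1)) k))\<^sup>2)"
    by (rule sum.swap)
  finally show ?thesis by (simp add: parseval assms sum_distrib_left)
qed

section \<open>Coarea inequality\<close>

text \<open>Subtracting the least value of \<open>p\<close> on \<open>U\<close> shrinks the support and changes the right-hand
  side by a multiple of the boundary of \<open>U\<close>; this replaces integration over level sets.\<close>

lemma coarea_inequality:
  fixes p :: "'a \<Rightarrow> real" and w :: "'i \<Rightarrow> 'a \<Rightarrow> 'a"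
  assumes "finite I"
    and cheeger: "\<And>U. finite U \<Longrightarrow> U \<subseteq> X \<Longrightarrow>
      c * real (card U) \<le> (\<Sum>i\<in>I. real (card {x\<in>U. w i x \<notin> U}))"
    and "finite U" "U \<subseteq> X" and "\<And>x. x \<in> U \<Longrightarrow> p x \<ge> 0" "\<And>x. x \<notin> U \<Longrightarrow> p x = 0"
  shows "c * (\<Sum>x\<in>U. p x) \<le> (\<Sum>i\<in>I. \<Sum>x\<in>U. max 0 (p x - p (w i x)))"
  using assms(3-)
proof (induction "card U" arbitrary: U p rule: less_induct)
  case less
  show ?case
  proof (cases "U = {}")
    case True
    then show ?thesis by simp
  next
    case False
    define m where "m = Min (p ` U)"
    have m: "m \<in> p ` U" "\<And>x. x \<in> U \<Longrightarrow> m \<le> p x"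
      using False less.prems by (auto simp: m_def)
    then have m0: "m \<ge> 0" using less.prems by auto
    define q where "q x = (if x \<in> U then p x - m else 0)" for x
    define U' where "U' = {x\<in>U. q x \<noteq> 0}"
    have "U' \<subset> U" using m(1) by (auto simp: U'_def q_def)
    have "c * (\<Sum>x\<in>U'. q x) \<le> (\<Sum>i\<in>I. \<Sum>x\<in>U'. max 0 (q x - q (w i x)))"
    proof (rule less.hyps)
      show "card U' < card U" using \<open>U' \<subset> U\<close> less.prems(1) psubset_card_mono by blast
      show "finite U'" "U' \<subseteq> X" using \<open>U' \<subset> U\<close> less.prems(1,2) finite_subset by blast+
      show "q x \<ge> 0" if "x \<in> U'" for x using that m(2) by (auto simp: U'_def q_def)
      show "q x = 0" if "x \<notin> U'" for x using that by (auto simp: U'_def q_def)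
    qed
    moreover have "(\<Sum>x\<in>U'. q x) = (\<Sum>x\<in>U. q x)"
      using less.prems(1) by (intro sum.mono_neutral_left) (auto simp: U'_def)
    \<comment> \<open>Where \<open>q\<close> vanishes the term is 0, since \<open>q\<close> is
      nonnegative at the target as well.\<close>
    moreover have "(\<Sum>x\<in>U'. max 0 (q x - q (w i x))) = (\<Sum>x\<in>U. max 0 (q x - q (w i x)))" for i
      using less.prems(1) m(2) by (intro sum.mono_neutral_left) (auto simp: U'_def q_def)
    ultimately have 1: "c * (\<Sum>x\<in>U. q x) \<le> (\<Sum>i\<in>I. \<Sum>x\<in>U. max 0 (q x - q (w i x)))" by simp
    \<comment> \<open>Subtracting \<open>m\<close> cancels along a step that stays in
      \<open>U\<close>; along a step leaving \<open>U\<close> it lowers the drop by exactly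
      \<open>m\<close>, as \<open>p x \<ge> m\<close> and \<open>p\<close> is 0 outside.\<close>
    have 2: "(\<Sum>x\<in>U. max 0 (p x - p (w i x))) =
        (\<Sum>x\<in>U. max 0 (q x - q (w i x))) + m * real (card {x\<in>U. w i x \<notin> U})" for i
    proof -
      have "(\<Sum>x\<in>U. max 0 (p x - p (w i x))) =
          (\<Sum>x\<in>U. max 0 (q x - q (w i x)) + (if w i x \<notin> U then m else 0))"
        using less.prems(3,4) m(2) m0 by (intro sum.cong refl) (auto simp: q_def max_def)
      also have "\<dots> = (\<Sum>x\<in>U. max 0 (q x - q (w i x))) + m * real (card {x\<in>U. w i x \<notin> U})"
        using less.prems(1) by (simp only: sum.distrib sum.inter_filter [symmetric]) simp
      finally show ?thesis .
    qed
    have "c * (\<Sum>x\<in>U. p x) = c * (\<Sum>x\<in>U. q x) + m * (c * real (card U))"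
      by (simp add: q_def sum_subtractf algebra_simps)
    also have "\<dots> \<le> (\<Sum>i\<in>I. \<Sum>x\<in>U. max 0 (q x - q (w i x))) +
        m * (\<Sum>i\<in>I. real (card {x\<in>U. w i x \<notin> U}))"
      using 1 cheeger [OF less.prems(1,2)] m0 by (intro add_mono mult_left_mono) auto
    also have "\<dots> = (\<Sum>i\<in>I. \<Sum>x\<in>U. max 0 (p x - p (w i x)))"
      by (simp add: 2 sum.distrib sum_distrib_left)
    finally show ?thesis .
  qed
qed

section \<open>Edge boundary of the lattice graph\<close>

lemma card_enter_eq_card_exit:
  assumes U: "finite U" and "bij w"
  shows "finite {x. x \<notin> U \<and> w x \<in> U}" "card {x. x \<notin> U \<and> w x \<in> U} = card {x\<in>U. w x \<notin> U}"
proof -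
  \<comment> \<open>Points entering and points leaving are the two differences of \<open>U\<close>
    and its preimage, which have equal size because the sets themselves do.\<close>
  have v: "finite (w -` U)" "card (w -` U) = card U"
    using assms by (auto intro: finite_vimageI bij_is_inj simp: card_vimage_inj bij_is_surj bij_is_inj)
  have "{x. x \<notin> U \<and> w x \<in> U} = w -` U - U" "{x\<in>U. w x \<notin> U} = U - w -` U" by auto
  then show "finite {x. x \<notin> U \<and> w x \<in> U}" "card {x. x \<notin> U \<and> w x \<in> U} = card {x\<in>U. w x \<notin> U}"
    using v U card_Diff_subset_Int [of U "w -` U"] card_Diff_subset_Int [of "w -` U" U]
    by (simp_all add: Int_commute)
qed

text \<open>A boundary edge \<open>{z, A *v z}\<close> is traversed either out of \<open>U\<close>
  or into \<open>U\<close>. Entries are as numerous as exits, whence the factor 2.\<close>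

lemma card_edge_boundary_lattice_graph:
  assumes U: "finite U" and AB: "bij ((*v) A)" "bij ((*v) B)"
  shows "card (edge_boundary (lattice_graph A B) U) \<le>
    2 * card {z\<in>U. A *v z \<notin> U} + 2 * card {z\<in>U. B *v z \<notin> U}"
proof -
  let ?X = "\<lambda>A. {z\<in>U. A *v z \<notin> U} \<union> {z. z \<notin> U \<and> A *v z \<in> U}"
  have X: "finite (?X A)" "card (?X A) \<le> 2 * card {z\<in>U. A *v z \<notin> U}" if "bij ((*v) A)" for A :: "int^2^2"
  proof -
    show "finite (?X A)" using card_enter_eq_card_exit(1) [OF U that] U by simp
    have "card (?X A) \<le> card {z\<in>U. A *v z \<notin> U} + card {z. z \<notin> U \<and> A *v z \<in> U}" by (rule card_Un_le)
    then show "card (?X A) \<le> 2 * card {z\<in>U. A *v z \<notin> U}"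
      unfolding card_enter_eq_card_exit(2) [OF U that] by linarith
  qed
  have "edge_boundary (lattice_graph A B) U \<subseteq> (\<lambda>z. {z, A *v z}) ` ?X A \<union> (\<lambda>z. {z, B *v z}) ` ?X B"
    by (auto simp: edge_boundary_def lattice_graph_def doubleton_eq_iff)
  then have "card (edge_boundary (lattice_graph A B) U) \<le>
      card ((\<lambda>z. {z, A *v z}) ` ?X A \<union> (\<lambda>z. {z, B *v z}) ` ?X B)"
    using X(1) AB by (intro card_mono) auto
  also have "\<dots> \<le> card (?X A) + card (?X B)"
    using X(1) AB by (intro order_trans [OF card_Un_le] add_mono card_image_le) auto
  also have "\<dots> \<le> 2 * card {z\<in>U. A *v z \<notin> U} + 2 * card {z\<in>U. B *v z \<notin> U}"
    using X(2) AB by (intro add_mono) auto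
  finally show ?thesis .
qed

section \<open>Low frequencies\<close>

text \<open>Entries lie below \<open>n / (2 * K)\<close> in absolute value. When \<open>K\<close>
  bounds the absolute row sums of a matrix, one matrix step then stays within \<open>n / 2\<close>,
  so no wrap-around occurs.\<close>

definition low_freq :: "nat \<Rightarrow> int \<Rightarrow> (int^2) set" where
  "low_freq n K = {k. \<forall>i. 2 * K * \<bar>k $ i\<bar> < int n}"

text \<open>Entries of a difference of two such vectors are smaller than \<open>n\<close> in
  absolute value, so they vanish if divisible by \<open>n\<close>.\<close>

lemma inj_on_reduce_mod_low_freq:
  assumes "K \<ge> 1" shows "inj_on (reduce_mod n) (low_freq n K)"
proof (rule inj_onI)
  fix k l assume kl: "k \<in> low_freq n K" "l \<in> low_freq n K" "reduce_mod n k = reduce_mod n l"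
  have "k $ i = l $ i" for i
  proof -
    have *: "2 * \<bar>m $ i\<bar> < int n" if "m \<in> low_freq n K" for m
    proof -
      have "1 * (2 * \<bar>m $ i\<bar>) \<le> K * (2 * \<bar>m $ i\<bar>)" using assms by (intro mult_right_mono) auto
      moreover have "2 * K * \<bar>m $ i\<bar> < int n" using that by (simp add: low_freq_def)
      ultimately show ?thesis by (simp add: mult_ac)
    qed
    have "int n dvd k $ i - l $ i" using kl(3) by (simp add: reduce_mod_eq_iff mod_eq_dvd_iff)
    moreover have "\<bar>k $ i - l $ i\<bar> < int n" using *[OF kl(1)] *[OF kl(2)] by linarith
    ultimately show ?thesis using dvd_imp_le_int [of "k $ i - l $ i" "int n"] by force
  qed
  then show "k = l" by (simp add: vec_eq_iff)
qed

text \<open>Some entry has absolute value between \<open>n / (2 * K)\<close> and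
  \<open>n / 2\<close>. Its angle lies between \<open>pi / K\<close> and \<open>pi\<close>, where
  the cosine decreases; one summand of the weight already suffices.\<close>

lemma freq_weight_lower:
  assumes K: "K \<ge> 1" and n: "n > 0" and k: "k \<notin> low_freq n K" and half: "\<And>i. 2 * \<bar>k $ i\<bar> \<le> int n"
  shows "freq_weight n k \<ge> 2 - 2 * cos (pi / real_of_int K)"
proof -
  obtain i where i: "2 * K * \<bar>k $ i\<bar> \<ge> int n" using k by (auto simp: low_freq_def not_less)
  let ?t = "2 * pi * real_of_int \<bar>k $ i\<bar> / real n"
  have "real n \<le> 2 * real_of_int K * real_of_int \<bar>k $ i\<bar>"
    using i by (metis of_int_le_iff of_int_mult of_int_numeral of_int_of_nat_eq)
  then have "pi * real n \<le> pi * (2 * real_of_int K * real_of_int \<bar>k $ i\<bar>)"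
    by (intro mult_left_mono) auto
  then have t1: "pi / real_of_int K \<le> ?t" using n K by (simp add: field_simps)
  have "2 * real_of_int \<bar>k $ i\<bar> \<le> real n"
    using half [of i] by (metis of_int_le_iff of_int_mult of_int_numeral of_int_of_nat_eq)
  then have "pi * (2 * real_of_int \<bar>k $ i\<bar>) \<le> pi * real n"
    by (intro mult_left_mono) auto
  then have t2: "?t \<le> pi" using n by (simp add: field_simps)
  have "cos ?t \<le> cos (pi / real_of_int K)"
    using t1 t2 K by (intro cos_monotone_0_pi_le) auto
  moreover have "cos ?t = cos (2 * pi * real_of_int (k $ i) / real n)"
    by (cases "k $ i \<ge> 0") (simp_all add: abs_if)
  ultimately have "2 - 2 * cos (pi / real_of_int K) \<le> 2 - 2 * cos (2 * pi * real_of_int (k $ i) / real n)"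
    by simp
  also have "\<dots> \<le> freq_weight n k"
    unfolding freq_weight_def by (rule member_le_sum) auto
  finally show ?thesis .
qed

lemma two_minus_two_cos_pos:
  fixes K :: int
  assumes "K > 1" shows "2 - 2 * cos (pi / real_of_int K) > 0"
proof -
  have "0 < pi / real_of_int K" "pi / real_of_int K \<le> pi / 1"
    using assms by (simp, intro divide_left_mono) auto
  then show ?thesis using cos_monotone_0_pi [of 0 "pi / real_of_int K"] by auto
qed

lemma ex_centred_representative:
  assumes "n > 0"
  shows "\<exists>l. reduce_mod n l = reduce_mod n k \<and> (\<forall>i. 2 * \<bar>l $ i\<bar> \<le> int n)"
proof -
  define l :: "int^2" where "l = (\<chi> i. let a = k $ i mod int n in if 2 * a \<le> int n then a else a - int n)"
  have "2 * \<bar>l $ i\<bar> \<le> int n" for i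
  proof -
    have "0 \<le> k $ i mod int n" "k $ i mod int n < int n" using assms by simp_all
    then show ?thesis unfolding l_def Let_def by (simp only: vec_lambda_beta split: if_split) auto
  qed
  moreover have "reduce_mod n l = reduce_mod n k"
    by (auto simp: reduce_mod_eq_iff l_def Let_def)
  ultimately show ?thesis by blast
qed

text \<open>A Markov-type bound: off the low frequencies the weight is bounded below, so the mass
  there is at most the weighted mass divided by that bound.\<close>

lemma sum_torus_le_low_freq:
  fixes p :: "int^2 \<Rightarrow> real"
  assumes p: "periodic n p" "\<And>k. p k \<ge> 0" and K: "K > 1" and n: "n > 0"
  shows "(\<Sum>k\<in>torus_verts n. p k) \<le>
    (\<Sum>k\<in>low_freq n K. p k) + (\<Sum>k\<in>torus_verts n. freq_weight n k * p k) / (2 - 2 * cos (pi / real_of_int K))"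
proof -
  let ?c = "2 - 2 * cos (pi / real_of_int K)" and ?V = "torus_verts n"
  let ?R = "reduce_mod n ` low_freq n K"
  have c: "?c > 0" using K by (rule two_minus_two_cos_pos)
  have high: "p k \<le> freq_weight n k * p k / ?c" if "k \<in> ?V - ?R" for k
  proof -
    obtain l where l: "reduce_mod n l = reduce_mod n k" "\<And>i. 2 * \<bar>l $ i\<bar> \<le> int n"
      using ex_centred_representative [OF n] by blast
    \<comment> \<open>If \<open>l\<close> were low, then \<open>k\<close>, which is its own residue
      and hence that of \<open>l\<close>, would belong to \<open>?R\<close>.\<close>
    have "l \<notin> low_freq n K" using that l(1) reduce_mod_id by force
    then have "?c \<le> freq_weight n l" using freq_weight_lower l(2) K n by simp
    also have "freq_weight n l = freq_weight n k"
      using periodic_cong [OF periodic_freq_weight [OF n] l(1)] .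
    finally have "p k * ?c \<le> freq_weight n k * p k" using p(2) by (simp add: mult.commute mult_left_mono)
    then show ?thesis using c by (simp add: pos_le_divide_eq)
  qed
  have "(\<Sum>k\<in>?V. p k) = (\<Sum>k\<in>?R. p k) + (\<Sum>k\<in>?V - ?R. p k)"
    using n by (subst sum.subset_diff [of ?R ?V]) auto
  also have "(\<Sum>k\<in>?R. p k) = (\<Sum>k\<in>low_freq n K. p k)"
    using inj_on_reduce_mod_low_freq [of K n] K by (simp add: sum.reindex periodicD [OF p(1)])
  also have "(\<Sum>k\<in>?V - ?R. p k) \<le> (\<Sum>k\<in>?V - ?R. freq_weight n k * p k / ?c)"
    using high by (rule sum_mono)
  also have "\<dots> \<le> (\<Sum>k\<in>?V. freq_weight n k * p k / ?c)"
    using c p(2) freq_weight_nonneg by (intro sum_mono2) auto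
  finally show ?thesis by (simp add: sum_divide_distrib)
qed

text \<open>A row of \<open>A\<close> has absolute sum at most \<open>K\<close>, and the entries of
  \<open>k\<close> are below \<open>n / (2 * K)\<close>. The estimate is carried out multiplied by
  \<open>K\<close> to avoid integer division.\<close>

lemma matrix_image_low_freq:
  assumes A: "\<And>i. (\<Sum>j\<in>UNIV. \<bar>A $ i $ j\<bar>) \<le> K" and K: "K \<ge> 1" and k: "k \<in> low_freq n K"
  shows "2 * \<bar>(A *v k) $ i\<bar> \<le> int n"
proof -
  have "K * (2 * \<bar>(A *v k) $ i\<bar>) \<le> 2 * K * (\<Sum>j\<in>UNIV. \<bar>A $ i $ j\<bar> * \<bar>k $ j\<bar>)"
    using K sum_abs [of "\<lambda>j. A $ i $ j * k $ j" UNIV] by (simp add: matrix_vector_mult_def abs_mult mult_ac)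
  also have "\<dots> = (\<Sum>j\<in>UNIV. \<bar>A $ i $ j\<bar> * (2 * K * \<bar>k $ j\<bar>))"
    by (simp add: sum_distrib_left mult_ac)
  also have "\<dots> \<le> (\<Sum>j\<in>UNIV. \<bar>A $ i $ j\<bar> * int n)"
    using k by (intro sum_mono mult_left_mono) (auto simp: low_freq_def intro: less_imp_le)
  also have "\<dots> \<le> K * int n"
    using A [of i] by (simp add: sum_distrib_right [symmetric] mult_right_mono)
  finally show ?thesis using K by simp
qed

section \<open>Cutoff and spectral estimate on the frequency side\<close>

lemma periodic_matrix: "periodic n p \<Longrightarrow> periodic n (\<lambda>z. p (A *v z))"
  unfolding periodic_def [of n "\<lambda>z. p (A *v z)"]
  using periodic_cong [OF _ reduce_mod_matrix] by metis

lemma finite_low_freq: "K \<ge> 1 \<Longrightarrow> n > 0 \<Longrightarrow> finite (low_freq n K)"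
  by (rule inj_on_finite [OF inj_on_reduce_mod_low_freq, where B = "torus_verts n"]) auto

text \<open>\<open>b\<close> records whether the step stays at low frequency. If so, factor the
  difference of squares and apply AM-GM with weight \<open>\<eta>\<close>; if not, the
  \<open>(cmod y)\<^sup>2\<close> lost by the cutoff is restored by the last term, as
  \<open>\<omega> \<ge> 1\<close>.\<close>

lemma boundary_term_le:
  fixes x y :: complex
  assumes "\<eta> > 0" "\<omega> \<ge> 0" and "\<not> b \<Longrightarrow> \<omega> \<ge> 1"
  shows "max 0 ((cmod x)\<^sup>2 - (if b then (cmod y)\<^sup>2 else 0)) \<le>
    2 * \<eta> * ((cmod x)\<^sup>2 + (cmod y)\<^sup>2) + (cmod (x - y))\<^sup>2 / (4 * \<eta>) + \<omega> * (cmod y)\<^sup>2"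
proof -
  let ?d = "cmod (x - y)" and ?s = "cmod x + cmod y"
  have "(cmod x)\<^sup>2 - (cmod y)\<^sup>2 = (cmod x - cmod y) * ?s"
    by (simp add: power2_eq_square algebra_simps)
  also have "\<dots> \<le> ?d * ?s"
    using norm_triangle_ineq2 [of x y] by (intro mult_right_mono) auto
  also have "\<dots> \<le> \<eta> * ?s\<^sup>2 + ?d\<^sup>2 / (4 * \<eta>)"
  proof -
    have "0 \<le> (2 * \<eta> * ?s - ?d)\<^sup>2 / (4 * \<eta>)" using assms(1) by simp
    also have "\<dots> = \<eta> * ?s\<^sup>2 + ?d\<^sup>2 / (4 * \<eta>) - ?d * ?s"
      using assms(1) by (simp add: power2_eq_square field_simps)
    finally show ?thesis by simp
  qed
  also have "\<eta> * ?s\<^sup>2 \<le> \<eta> * (2 * ((cmod x)\<^sup>2 + (cmod y)\<^sup>2))"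
    using assms(1) sum_squares_bound [of "cmod x" "cmod y"]
    by (intro mult_left_mono) (simp_all add: power2_sum)
  finally have 1: "(cmod x)\<^sup>2 - (cmod y)\<^sup>2 \<le> 2 * \<eta> * ((cmod x)\<^sup>2 + (cmod y)\<^sup>2) + ?d\<^sup>2 / (4 * \<eta>)"
    by (simp add: mult_ac)
  have 2: "(if b then 0 else (cmod y)\<^sup>2) \<le> \<omega> * (cmod y)\<^sup>2"
  proof (cases b)
    case True
    then show ?thesis using assms(2) by simp
  next
    case False
    then show ?thesis using mult_right_mono [OF assms(3), of "(cmod y)\<^sup>2"] by simp
  qed
  have "0 \<le> 2 * \<eta> * ((cmod x)\<^sup>2 + (cmod y)\<^sup>2) + ?d\<^sup>2 / (4 * \<eta>) + \<omega> * (cmod y)\<^sup>2"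
    using assms(1,2) by simp
  then show ?thesis using 1 2 by (cases b) simp_all
qed

text \<open>A step leaving the low frequencies ends at a vector with entries of absolute value at most
  \<open>n/2\<close>, where \<open>freq_weight\<close> is at least \<open>\<kappa>\<close>, so the cutoff error is paid for by the shift energy.\<close>

lemma cutoff_variation_le:
  fixes F :: "int^2 \<Rightarrow> complex" and K :: int and n :: nat
  defines "h \<equiv> \<lambda>k. if k \<in> low_freq n K then (cmod (F k))\<^sup>2 else 0"
    and "\<kappa> \<equiv> 2 - 2 * cos (pi / real_of_int K)"
  assumes F: "periodic n F" and n: "n > 0" and K: "K > 1" and \<eta>: "\<eta> > 0"
    and A: "invertible A" "\<And>i. (\<Sum>j\<in>UNIV. \<bar>A $ i $ j\<bar>) \<le> K"
  shows "(\<Sum>k\<in>low_freq n K. max 0 (h k - h (A *v k))) \<le>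
    4 * \<eta> * (\<Sum>k\<in>torus_verts n. (cmod (F k))\<^sup>2) +
    (\<Sum>k\<in>torus_verts n. (cmod (F k - F (A *v k)))\<^sup>2) / (4 * \<eta>) +
    (\<Sum>k\<in>torus_verts n. freq_weight n k * (cmod (F k))\<^sup>2) / \<kappa>"
proof -
  let ?V = "torus_verts n" and ?L = "low_freq n K"
  define q where "q k = (cmod (F k))\<^sup>2" for k
  define d where "d k = (cmod (F k - F (A *v k)))\<^sup>2" for k
  define r where "r k = freq_weight n k * q k" for k
  obtain A' where A': "A ** A' = mat 1" "A' ** A = mat 1"
    using A(1) by (auto simp: invertible_def)
  have \<kappa>: "\<kappa> > 0" using two_minus_two_cos_pos [OF K] by (simp add: \<kappa>_def)
  have q: "periodic n q" using periodicD [OF F] by (simp add: periodic_def q_def)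
  have d: "periodic n d"
    using periodicD [OF F] periodicD [OF periodic_matrix [OF F]] by (simp add: periodic_def d_def)
  have r: "periodic n r"
    using periodicD [OF periodic_freq_weight [OF n]] periodicD [OF q] by (simp add: periodic_def r_def)
  have nonneg: "q k \<ge> 0" "d k \<ge> 0" "r k \<ge> 0" for k
    by (simp_all add: q_def d_def r_def freq_weight_nonneg)
  have le_torus: "(\<Sum>k\<in>?L. p k) \<le> (\<Sum>k\<in>?V. p k)" if "periodic n p" "\<And>k. p k \<ge> 0" for p :: "int^2 \<Rightarrow> real"
    using that n inj_on_reduce_mod_low_freq [of K n] K by (intro sum_le_sum_torus) auto
  \<comment> \<open>The points \<open>A *v k\<close> may leave \<open>?L\<close>, so the bound is
    applied to \<open>p\<close> composed with \<open>A\<close>, which has the same sum over the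
    torus.\<close>
  have le_torus': "(\<Sum>k\<in>?L. p (A *v k)) \<le> (\<Sum>k\<in>?V. p k)" if "periodic n p" "\<And>k. p k \<ge> 0" for p :: "int^2 \<Rightarrow> real"
    unfolding sum_torus_matrix [OF that(1) n A', symmetric]
    by (rule le_torus [OF periodic_matrix [OF that(1)] that(2)])
  have "(\<Sum>k\<in>?L. max 0 (h k - h (A *v k))) \<le>
      (\<Sum>k\<in>?L. 2 * \<eta> * (q k + q (A *v k)) + d k / (4 * \<eta>) + r (A *v k) / \<kappa>)"
  proof (rule sum_mono)
    fix k assume k: "k \<in> ?L"
    have "freq_weight n (A *v k) / \<kappa> \<ge> 1" if "A *v k \<notin> ?L"
      using freq_weight_lower [OF _ n that matrix_image_low_freq [OF A(2) _ k]] K \<kappa>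
      by (simp add: \<kappa>_def)
    then show "max 0 (h k - h (A *v k)) \<le> 2 * \<eta> * (q k + q (A *v k)) + d k / (4 * \<eta>) + r (A *v k) / \<kappa>"
      using boundary_term_le [OF \<eta>, of "freq_weight n (A *v k) / \<kappa>" "A *v k \<in> ?L" "F k" "F (A *v k)"]
        k \<kappa> freq_weight_nonneg [of n "A *v k"]
      by (simp add: h_def q_def d_def r_def)
  qed
  also have "\<dots> = 2 * \<eta> * ((\<Sum>k\<in>?L. q k) + (\<Sum>k\<in>?L. q (A *v k))) + (\<Sum>k\<in>?L. d k) / (4 * \<eta>) + (\<Sum>k\<in>?L. r (A *v k)) / \<kappa>"
    by (simp add: sum.distrib flip: sum_distrib_left sum_divide_distrib)
  also have "\<dots> \<le> 2 * \<eta> * ((\<Sum>k\<in>?V. q k) + (\<Sum>k\<in>?V. q k)) + (\<Sum>k\<in>?V. d k) / (4 * \<eta>) + (\<Sum>k\<in>?V. r k) / \<kappa>"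
    using \<eta> \<kappa> nonneg q d r
    by (intro add_mono mult_left_mono divide_right_mono le_torus le_torus') auto
  finally show ?thesis by (simp add: q_def d_def r_def)
qed

text \<open>The coarea inequality bounds the low-frequency mass by the variation of the cut-off
  squared modulus, and the weight bounds the remaining mass. The factor \<open>c / 2\<close> is what
  is left after absorbing the \<open>\<eta>\<close> terms.\<close>

lemma spectral_estimate:
  fixes F :: "int^2 \<Rightarrow> complex" and K :: int and n :: nat and \<A> :: "(int^2^2) set"
  defines "\<kappa> \<equiv> 2 - 2 * cos (pi / real_of_int K)"
  assumes F: "periodic n F" "F 0 = 0" and n: "n > 0" and K: "K > 1"
    and \<A>: "finite \<A>" "\<And>A. A \<in> \<A> \<Longrightarrow> invertible A"
      "\<And>A i. A \<in> \<A> \<Longrightarrow> (\<Sum>j\<in>UNIV. \<bar>A $ i $ j\<bar>) \<le> K"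
    and c: "c > 0"
    and cheeger: "\<And>U. finite U \<Longrightarrow> U \<subseteq> - {0} \<Longrightarrow>
      c * real (card U) \<le> (\<Sum>A\<in>\<A>. real (card {k\<in>U. A *v k \<notin> U}))"
  shows "c / 2 * (\<Sum>k\<in>torus_verts n. (cmod (F k))\<^sup>2) \<le>
    2 * (real (card \<A>) + 1) / c * (\<Sum>A\<in>\<A>. \<Sum>k\<in>torus_verts n. (cmod (F k - F (A *v k)))\<^sup>2) +
    (real (card \<A>) + c) / \<kappa> * (\<Sum>k\<in>torus_verts n. freq_weight n k * (cmod (F k))\<^sup>2)"
proof -
  let ?L = "low_freq n K" and ?m = "real (card \<A>)"
  define h where "h k = (if k \<in> ?L then (cmod (F k))\<^sup>2 else 0)" for k
  define G where "G = (\<Sum>k\<in>torus_verts n. (cmod (F k))\<^sup>2)"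
  define D where "D A = (\<Sum>k\<in>torus_verts n. (cmod (F k - F (A *v k)))\<^sup>2)" for A
  define P where "P = (\<Sum>k\<in>torus_verts n. freq_weight n k * (cmod (F k))\<^sup>2)"
  \<comment> \<open>Chosen so that \<open>card \<A> * 4 * \<eta> \<le> c / 2\<close>; the
    \<open>+ 1\<close> keeps the denominator positive even for empty \<open>\<A>\<close>.\<close>
  define \<eta> where "\<eta> = c / (8 * (?m + 1))"
  have \<eta>: "\<eta> > 0" using c by (simp add: \<eta>_def)
  have G: "G \<ge> 0" by (simp add: G_def sum_nonneg)
  have L: "finite ?L" using K n by (intro finite_low_freq) auto
  \<comment> \<open>Cheeger sets must avoid 0, and \<open>F 0 = 0\<close> allows its removal at no
    cost.\<close>
  have "(\<Sum>k\<in>?L. (cmod (F k))\<^sup>2) = (\<Sum>k\<in>?L - {0}. h k)"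
    using L F(2) by (intro sum.mono_neutral_cong_right) (auto simp: h_def)
  then have "c * (\<Sum>k\<in>?L. (cmod (F k))\<^sup>2) = c * (\<Sum>k\<in>?L - {0}. h k)" by simp
  also have "\<dots> \<le> (\<Sum>A\<in>\<A>. \<Sum>k\<in>?L - {0}. max 0 (h k - h (A *v k)))"
  proof (rule coarea_inequality [where X = "- {0}", OF \<A>(1) cheeger])
    show "h k = 0" if "k \<notin> ?L - {0}" for k using that F(2) by (auto simp: h_def)
  qed (use L in \<open>auto simp: h_def\<close>)
  also have "\<dots> \<le> (\<Sum>A\<in>\<A>. \<Sum>k\<in>?L. max 0 (h k - h (A *v k)))"
    using L by (intro sum_mono sum_mono2) auto
  also have "\<dots> \<le> (\<Sum>A\<in>\<A>. 4 * \<eta> * G + D A / (4 * \<eta>) + P / \<kappa>)"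
    unfolding h_def G_def D_def P_def \<kappa>_def
    by (intro sum_mono cutoff_variation_le F n K \<eta> \<A>)
  also have "\<dots> = ?m * (4 * \<eta>) * G + (\<Sum>A\<in>\<A>. D A) / (4 * \<eta>) + ?m * P / \<kappa>"
    by (simp add: sum.distrib sum_divide_distrib)
  also have "?m * (4 * \<eta>) * G \<le> c / 2 * G"
    using G c by (intro mult_right_mono) (simp_all add: \<eta>_def field_simps)
  finally have 1: "c * (\<Sum>k\<in>?L. (cmod (F k))\<^sup>2) \<le> c / 2 * G + (\<Sum>A\<in>\<A>. D A) / (4 * \<eta>) + ?m * P / \<kappa>"
    by simp
  have "G \<le> (\<Sum>k\<in>?L. (cmod (F k))\<^sup>2) + P / \<kappa>"
    unfolding G_def P_def \<kappa>_def
    using periodicD [OF F(1)] by (intro sum_torus_le_low_freq K n) (auto simp: periodic_def)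
  then have "c * G \<le> c * ((\<Sum>k\<in>?L. (cmod (F k))\<^sup>2) + P / \<kappa>)" using c by simp
  with 1 have "c / 2 * G \<le> (\<Sum>A\<in>\<A>. D A) / (4 * \<eta>) + (?m * P / \<kappa> + c * (P / \<kappa>))"
    by (simp add: distrib_left)
  also have "?m * P / \<kappa> + c * (P / \<kappa>) = (?m + c) / \<kappa> * P"
    by (simp add: add_divide_distrib distrib_right)
  also have "(\<Sum>A\<in>\<A>. D A) / (4 * \<eta>) = 2 * (?m + 1) / c * (\<Sum>A\<in>\<A>. D A)"
    using c by (simp add: \<eta>_def field_simps)
  finally show ?thesis by (simp add: G_def D_def P_def)
qed

section \<open>The torus graph\<close>

lemma torus_neighbours_subset: "n > 0 \<Longrightarrow> torus_neighbours S T n z \<subseteq> torus_verts n"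
  by (auto simp: torus_neighbours_def)

lemma edges_torus_graph_subset: "n > 0 \<Longrightarrow> edges (torus_graph S T n) \<subseteq> Pow (torus_verts n)"
  using torus_neighbours_subset [of n S T] by (auto simp: torus_graph_def)

lemma edge_energy_nonneg: "e \<in> edges (torus_graph S T n) \<Longrightarrow> edge_energy f e \<ge> 0"
  by (auto simp: torus_graph_def edge_energy_doubleton)

text \<open>The factor 2 is needed since an edge \<open>{z, w}\<close> may arise both from \<open>z\<close> and from \<open>w\<close>.\<close>

lemma sum_neighbour_le_edge_energy:
  assumes n: "n > 0" and \<phi>: "\<And>z. z \<in> torus_verts n \<Longrightarrow> \<phi> z \<in> torus_neighbours S T n z"
  shows "(\<Sum>z\<in>torus_verts n. (cmod (f z - f (\<phi> z)))\<^sup>2) \<le> 2 * (\<Sum>e\<in>edges (torus_graph S T n). edge_energy f e)"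
proof -
  let ?V = "torus_verts n" and ?E = "edges (torus_graph S T n)"
  have sub: "(\<lambda>z. {z, \<phi> z}) ` ?V \<subseteq> ?E" using \<phi> by (auto simp: torus_graph_def)
  have fin: "finite ?E" by (rule finite_subset [OF edges_torus_graph_subset [OF n]]) simp
  have "(\<Sum>z\<in>?V. (cmod (f z - f (\<phi> z)))\<^sup>2) = (\<Sum>z\<in>?V. edge_energy f {z, \<phi> z})"
    by (simp add: edge_energy_doubleton)
  also have "\<dots> = (\<Sum>e\<in>(\<lambda>z. {z, \<phi> z}) ` ?V. \<Sum>z\<in>{z\<in>?V. {z, \<phi> z} = e}. edge_energy f {z, \<phi> z})"
    by (rule sum.image_gen) simp
  also have "\<dots> = (\<Sum>e\<in>(\<lambda>z. {z, \<phi> z}) ` ?V. real (card {z\<in>?V. {z, \<phi> z} = e}) * edge_energy f e)"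
    by (intro sum.cong refl) simp
  also have "\<dots> \<le> (\<Sum>e\<in>(\<lambda>z. {z, \<phi> z}) ` ?V. 2 * edge_energy f e)"
  proof (intro sum_mono mult_right_mono)
    fix e assume e: "e \<in> (\<lambda>z. {z, \<phi> z}) ` ?V"
    then obtain w where w: "e = {w, \<phi> w}" by blast
    have "card {z\<in>?V. {z, \<phi> z} = e} \<le> card {w, \<phi> w}"
      by (rule card_mono) (auto simp: w)
    also have "\<dots> \<le> 2" by (simp add: card_insert_if)
    finally show "real (card {z\<in>?V. {z, \<phi> z} = e}) \<le> 2" by simp
    show "edge_energy f e \<ge> 0" using e sub edge_energy_nonneg by blast
  qed
  also have "\<dots> \<le> (\<Sum>e\<in>?E. 2 * edge_energy f e)"
    using sub fin edge_energy_nonneg by (intro sum_mono2) auto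
  finally show ?thesis by (simp add: sum_distrib_left)
qed

section \<open>Invertibility, symmetry of neighbours and bounded degree\<close>

lemma invertible_matrix_inv:
  fixes A :: "'a::semiring_1^'n^'m"
  assumes "invertible A"
  shows "A ** matrix_inv A = mat 1" "matrix_inv A ** A = mat 1"
  using someI_ex [OF assms [unfolded invertible_def]] by (simp_all add: matrix_inv_def)

lemma invertible_transpose_comm_semiring:
  fixes A :: "'a::comm_semiring_1^'n^'m"
  assumes "invertible A" shows "invertible (transpose A)"
  using assms unfolding invertible_def by (metis matrix_transpose_mul transpose_mat)

lemma bij_matrix_vector:
  fixes A :: "'a::semiring_1^'n^'m"
  assumes "invertible A" shows "bij ((*v) A)"
  using invertible_matrix_inv [OF assms]
  by (intro o_bij [where g = "(*v) (matrix_inv A)"]) (auto simp: fun_eq_iff matrix_vector_mul_assoc)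

lemma is_ugraph_torus_graph: "n > 0 \<Longrightarrow> is_ugraph (torus_graph S T n)"
  using torus_neighbours_subset [of n S T] by (auto simp: is_ugraph_def torus_graph_def)

text \<open>The eight moves form mutually inverse pairs, each compatible with reduction modulo
  \<open>n\<close>.\<close>

lemma torus_neighbours_symmetric:
  assumes n: "n > 0" and S: "invertible S" and T: "invertible T"
    and z: "z \<in> torus_verts n" and w: "w \<in> torus_neighbours S T n z"
  shows "z \<in> torus_neighbours S T n w"
proof -
  have shift: "z = reduce_mod n (w - a)" if "w = reduce_mod n (z + a)" for a
    using that reduce_mod_add_left [of n "z + a" "- a"] z by (simp add: reduce_mod_id)
  have shift': "z = reduce_mod n (w + a)" if "w = reduce_mod n (z - a)" for a
    using that reduce_mod_add_left [of n "z - a" a] z by (simp add: reduce_mod_id)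
  have mat: "z = reduce_mod n (B *v w)" if "w = reduce_mod n (A *v z)" "B ** A = mat 1" for A B
    using that z by (simp add: reduce_mod_matrix matrix_vector_mul_assoc reduce_mod_id)
  note * = shift [of "vector [1, 0]"] shift [of "vector [0, 1]"] shift' [of "vector [1, 0]"] shift' [of "vector [0, 1]"]
    mat [OF _ invertible_matrix_inv(2) [OF S]] mat [OF _ invertible_matrix_inv(1) [OF S]]
    mat [OF _ invertible_matrix_inv(2) [OF T]] mat [OF _ invertible_matrix_inv(1) [OF T]]
  show ?thesis
    using w * unfolding torus_neighbours_def image_insert image_empty insert_iff empty_iff by argo
qed

text \<open>By symmetry, an edge listed from its other endpoint also comes from a neighbour of
  \<open>v\<close>, so eight moves account for all edges at \<open>v\<close>.\<close>

lemma degrees_torus_graph: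
  assumes "n > 0" "invertible S" "invertible T"
  shows "degrees_bounded_by 8 (torus_graph S T n)"
  unfolding degrees_bounded_by_def
proof
  fix v assume "v \<in> verts (torus_graph S T n)"
  let ?E = "{e \<in> edges (torus_graph S T n). v \<in> e}"
  have fin: "finite (torus_neighbours S T n v)" by (simp add: torus_neighbours_def)
  have "?E \<subseteq> (\<lambda>w. {v, w}) ` torus_neighbours S T n v"
    using torus_neighbours_symmetric [OF assms] by (auto simp: torus_graph_def)
  then have "finite ?E" "card ?E \<le> card (torus_neighbours S T n v)"
    using fin by (auto intro: finite_subset surj_card_le)
  moreover have "card (torus_neighbours S T n v) \<le> 8"
  proof -
    let ?l = "[v + vector [1, 0], v - vector [1, 0], v + vector [0, 1], v - vector [0, 1],
      S *v v, matrix_inv S *v v, T *v v, matrix_inv T *v v]"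
    have "torus_neighbours S T n v = set (map (reduce_mod n) ?l)"
      by (simp add: torus_neighbours_def)
    then show ?thesis using card_length [of "map (reduce_mod n) ?l"] by simp
  qed
  ultimately show "finite ?E \<and> card ?E \<le> 8" by simp
qed

section \<open>Uniform lower bound for \<open>lambda2\<close>\<close>

lemma lambda2_ge:
  assumes n: "n \<ge> 2"
    and bound: "\<And>f. (\<Sum>u\<in>torus_verts n. f u) = 0 \<Longrightarrow>
      c * (\<Sum>u\<in>torus_verts n. (cmod (f u))\<^sup>2) \<le> (\<Sum>e\<in>edges (torus_graph S T n). edge_energy f e)"
  shows "lambda2 (torus_graph S T n) \<ge> c"
  unfolding lambda2_def
proof (rule cInf_greatest)
  let ?a = "axis 1 1 :: int^2"
  \<comment> \<open>A lower bound passes to \<open>Inf\<close> only for a nonempty set. The witness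
    is a difference of two point masses; \<open>n \<ge> 2\<close> makes \<open>?a\<close> a
    vertex.\<close>
  let ?f = "\<lambda>u. (if u = 0 then 1 else 0) - (if u = ?a then 1 else 0) :: complex"
  have V: "0 \<in> torus_verts n" "?a \<in> torus_verts n" "?a \<noteq> 0"
    using n by (auto simp: torus_verts_def axis_def vec_eq_iff)
  then have "?f 0 \<noteq> 0" "(\<Sum>u\<in>torus_verts n. ?f u) = 0" by (simp_all add: sum_subtractf)
  then show "{(\<Sum>e\<in>edges (torus_graph S T n). edge_energy f e) / (\<Sum>u\<in>verts (torus_graph S T n). (cmod (f u))\<^sup>2) | f.
      (\<exists>u\<in>verts (torus_graph S T n). f u \<noteq> 0) \<and> (\<Sum>u\<in>verts (torus_graph S T n). f u) = 0} \<noteq> {}"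
    using V(1) by (simp add: torus_graph_def, intro exI [of _ ?f]) auto
next
  fix x assume "x \<in> {(\<Sum>e\<in>edges (torus_graph S T n). edge_energy f e) / (\<Sum>u\<in>verts (torus_graph S T n). (cmod (f u))\<^sup>2) | f.
      (\<exists>u\<in>verts (torus_graph S T n). f u \<noteq> 0) \<and> (\<Sum>u\<in>verts (torus_graph S T n). f u) = 0}"
  then obtain f u where f: "x = (\<Sum>e\<in>edges (torus_graph S T n). edge_energy f e) / (\<Sum>u\<in>torus_verts n. (cmod (f u))\<^sup>2)"
      "u \<in> torus_verts n" "f u \<noteq> 0" "(\<Sum>u\<in>torus_verts n. f u) = 0"
    by (auto simp: torus_graph_def)
  have "(\<Sum>u\<in>torus_verts n. (cmod (f u))\<^sup>2) > 0"
    using f(2,3) by (intro sum_pos2 [where i = u]) auto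
  then show "c \<le> x" using bound [OF f(4)] by (simp add: f(1) pos_le_divide_eq)
qed

text \<open>Applies \<open>spectral_estimate\<close> to the transform of the periodic extension of
  \<open>f\<close>. Each 4 is two matrices, or two coordinate directions, times the 2 from
  \<open>sum_neighbour_le_edge_energy\<close>.\<close>

lemma torus_spectral_gap:
  fixes S T :: "int^2^2" and K :: int
  defines "\<A> \<equiv> {transpose S, transpose T}"
  assumes n: "n > 0" and S: "invertible S" and T: "invertible T" and K: "K > 1"
    and rows: "\<And>A i. A \<in> \<A> \<Longrightarrow> (\<Sum>j\<in>UNIV. \<bar>A $ i $ j\<bar>) \<le> K"
    and c: "c > 0"
    and cheeger: "\<And>U. finite U \<Longrightarrow> U \<subseteq> - {0} \<Longrightarrow>
      c * real (card U) \<le> (\<Sum>A\<in>\<A>. real (card {k\<in>U. A *v k \<notin> U}))"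
    and f: "(\<Sum>u\<in>torus_verts n. f u) = 0"
  shows "c / 2 * (\<Sum>u\<in>torus_verts n. (cmod (f u))\<^sup>2) \<le>
    (2 * (real (card \<A>) + 1) / c * 4 + (real (card \<A>) + c) / (2 - 2 * cos (pi / real_of_int K)) * 4) *
    (\<Sum>e\<in>edges (torus_graph S T n). edge_energy f e)"
proof -
  let ?V = "torus_verts n"
  define E where "E = (\<Sum>e\<in>edges (torus_graph S T n). edge_energy f e)"
  define N where "N = real (card ?V)"
  define a where "a = 2 * (real (card \<A>) + 1) / c"
  define b where "b = (real (card \<A>) + c) / (2 - 2 * cos (pi / real_of_int K))"
  define g where "g z = f (reduce_mod n z)" for z
  have g: "periodic n g" by (simp add: periodic_def g_def)
  have gf: "g z = f z" if "z \<in> ?V" for z using that by (simp add: g_def reduce_mod_id)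
  have N: "N > 0" using reduce_mod_in_verts [OF n, of 0] by (auto simp: N_def card_gt_0_iff)
  have a: "a \<ge> 0" using c by (simp add: a_def)
  have b: "b \<ge> 0" using c by (simp add: b_def)
  have E: "E \<ge> 0" using edge_energy_nonneg by (auto simp: E_def intro: sum_nonneg)
  have nb: "(\<Sum>z\<in>?V. (cmod (g z - g (\<phi> z)))\<^sup>2) \<le> 2 * E"
    if "\<And>z. reduce_mod n (\<phi> z) \<in> torus_neighbours S T n z" for \<phi>
  proof -
    have "(\<Sum>z\<in>?V. (cmod (g z - g (\<phi> z)))\<^sup>2) = (\<Sum>z\<in>?V. (cmod (f z - f (reduce_mod n (\<phi> z))))\<^sup>2)"
      by (intro sum.cong refl) (simp add: gf, simp add: g_def)
    also have "\<dots> \<le> 2 * E"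
      unfolding E_def by (rule sum_neighbour_le_edge_energy [OF n that])
    finally show ?thesis .
  qed
  have matrix: "(\<Sum>k\<in>?V. (cmod (dft n g k - dft n g (transpose A *v k)))\<^sup>2) \<le> N * (2 * E)"
    if "A = S \<or> A = T" for A
  proof -
    have A: "invertible A" using that S T by auto
    \<comment> \<open>On the frequency side \<open>transpose A\<close> corresponds to
      \<open>matrix_inv A\<close> on the torus, so the inverse moves are the ones compared with
      edges.\<close>
    have "reduce_mod n (matrix_inv A *v z) \<in> torus_neighbours S T n z" for z
      using that by (auto simp: torus_neighbours_def)
    then show ?thesis
      unfolding matrix_energy [OF g n invertible_matrix_inv [OF A]] N_def
      by (intro mult_left_mono nb) auto
  qed
  have "(\<Sum>A\<in>\<A>. \<Sum>k\<in>?V. (cmod (dft n g k - dft n g (A *v k)))\<^sup>2) \<le> (\<Sum>A\<in>\<A>. N * (2 * E))"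
    using matrix by (intro sum_mono) (auto simp: \<A>_def simp del: transpose_matrix_vector)
  \<comment> \<open>Only an inequality, since \<open>\<A>\<close> is a singleton when the two
    transposes agree.\<close>
  also have "\<dots> \<le> 2 * (N * (2 * E))"
    using N E by (simp add: \<A>_def card_insert_if)
  finally have D: "(\<Sum>A\<in>\<A>. \<Sum>k\<in>?V. (cmod (dft n g k - dft n g (A *v k)))\<^sup>2) \<le> N * (4 * E)"
    by simp
  have "axis 1 1 = (vector [1, 0] :: int^2)" "axis 2 1 = (vector [0, 1] :: int^2)"
    by (auto simp: vec_eq_iff forall_2 axis_def)
  then have "reduce_mod n (z + axis i 1) \<in> torus_neighbours S T n z" for z and i :: 2
    using exhaust_2 [of i] by (auto simp: torus_neighbours_def)
  then have "(\<Sum>i\<in>(UNIV::2 set). \<Sum>z\<in>?V. (cmod (g z - g (z + axis i 1)))\<^sup>2) \<le> (\<Sum>i\<in>(UNIV::2 set). 2 * E)"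
    by (intro sum_mono nb)
  then have "N * (\<Sum>i\<in>(UNIV::2 set). \<Sum>z\<in>?V. (cmod (g z - g (z + axis i 1)))\<^sup>2) \<le> N * (4 * E)"
    using N by (intro mult_left_mono) auto
  then have P: "(\<Sum>k\<in>?V. freq_weight n k * (cmod (dft n g k))\<^sup>2) \<le> N * (4 * E)"
    unfolding shift_energy [OF g n] N_def .
  have "dft n g 0 = 0" using f by (simp add: dft_0 gf)
  then have "c / 2 * (\<Sum>k\<in>?V. (cmod (dft n g k))\<^sup>2) \<le>
      a * (\<Sum>A\<in>\<A>. \<Sum>k\<in>?V. (cmod (dft n g k - dft n g (A *v k)))\<^sup>2) +
      b * (\<Sum>k\<in>?V. freq_weight n k * (cmod (dft n g k))\<^sup>2)"
    unfolding a_def b_def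
    by (intro spectral_estimate periodic_dft n K c rows cheeger)
      (auto simp: \<A>_def invertible_transpose_comm_semiring S T)
  also have "\<dots> \<le> a * (N * (4 * E)) + b * (N * (4 * E))"
    using a b D P by (intro add_mono mult_left_mono)
  also have "\<dots> = N * ((a * 4 + b * 4) * E)" by (simp add: algebra_simps)
  \<comment> \<open>Parseval puts the factor \<open>N\<close> on the left as well, so it cancels and
    the constant does not depend on \<open>n\<close>.\<close>
  finally have "N * (c / 2 * (\<Sum>z\<in>?V. (cmod (f z))\<^sup>2)) \<le> N * ((a * 4 + b * 4) * E)"
    by (simp add: parseval n N_def gf mult_ac)
  then show ?thesis using N by (simp add: a_def b_def E_def)
qed

theorem theorem1p1:
  fixes S T :: "int^2^2"
  assumes "invertible S" and "invertible T"
    and "positive_cheeger_constant (lattice_graph (transpose S) (transpose T))"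
  shows "expander_family {2..} (torus_graph S T)"
proof -
  let ?\<A> = "{transpose S, transpose T}"
  obtain \<epsilon> :: real where \<epsilon>: "\<epsilon> > 0" and boundary: "\<And>U. finite U \<Longrightarrow> U \<subseteq> - {0} \<Longrightarrow>
      \<epsilon> * real (card U) \<le> real (card (edge_boundary (lattice_graph (transpose S) (transpose T)) U))"
    using assms(3) by (auto simp: positive_cheeger_constant_def lattice_graph_def)
  \<comment> \<open>One factor 2 counts entries along with exits; the other covers equal transposes,
    when the sum over the set counts the single matrix only once.\<close>
  define c where "c = \<epsilon> / 4"
  have c: "c > 0" using \<epsilon> by (simp add: c_def)
  have cheeger: "c * real (card U) \<le> (\<Sum>A\<in>?\<A>. real (card {k\<in>U. A *v k \<notin> U}))"
    if U: "finite U" "U \<subseteq> - {0}" for U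
  proof -
    let ?x = "\<lambda>A. card {k\<in>U. A *v k \<notin> U}"
    have "card (edge_boundary (lattice_graph (transpose S) (transpose T)) U) \<le>
        2 * ?x (transpose S) + 2 * ?x (transpose T)"
      by (intro card_edge_boundary_lattice_graph U bij_matrix_vector invertible_transpose_comm_semiring assms)
    then have "\<epsilon> * real (card U) \<le> real (2 * ?x (transpose S) + 2 * ?x (transpose T))"
      using boundary [OF U] by linarith
    also have "\<dots> \<le> 4 * (\<Sum>A\<in>?\<A>. real (?x A))"
      by (cases "transpose S = transpose T") simp_all
    finally show ?thesis by (simp add: c_def)
  qed
  \<comment> \<open>Dominates every absolute row sum of both matrices; the summand 2 ensures
    \<open>K > 1\<close>.\<close>
  define K where "K = 2 + (\<Sum>A\<in>?\<A>. \<Sum>i\<in>UNIV. \<Sum>j\<in>UNIV. \<bar>A $ i $ j\<bar>)"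
  have K: "K > 1" unfolding K_def by (smt (verit) sum_nonneg abs_ge_zero)
  have rows: "(\<Sum>j\<in>UNIV. \<bar>A $ i $ j\<bar>) \<le> K" if "A \<in> ?\<A>" for A i
  proof -
    have "(\<Sum>j\<in>UNIV. \<bar>A $ i $ j\<bar>) \<le> (\<Sum>i\<in>UNIV. \<Sum>j\<in>UNIV. \<bar>A $ i $ j\<bar>)"
      by (rule member_le_sum) (auto intro: sum_nonneg)
    also have "\<dots> \<le> (\<Sum>A\<in>?\<A>. \<Sum>i\<in>UNIV. \<Sum>j\<in>UNIV. \<bar>A $ i $ j\<bar>)"
      using that by (intro member_le_sum [where f = "\<lambda>A. \<Sum>i\<in>UNIV. \<Sum>j\<in>UNIV. \<bar>A $ i $ j\<bar>"]) (auto intro!: sum_nonneg)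
    finally show ?thesis by (simp add: K_def)
  qed
  define C where "C = 2 * (real (card ?\<A>) + 1) / c * 4 +
    (real (card ?\<A>) + c) / (2 - 2 * cos (pi / real_of_int K)) * 4"
  have C: "C > 0"
    unfolding C_def using c by (intro add_pos_nonneg) auto
  \<comment> \<open>\<open>c\<close>, \<open>K\<close> and \<open>C\<close> were fixed before
    \<open>n\<close>, so the bound is uniform over the family.\<close>
  have "lambda2 (torus_graph S T n) \<ge> c / (2 * C)" if "n \<ge> 2" for n
  proof (rule lambda2_ge [OF that])
    fix f :: "int^2 \<Rightarrow> complex" assume "(\<Sum>u\<in>torus_verts n. f u) = 0"
    then have "c / 2 * (\<Sum>u\<in>torus_verts n. (cmod (f u))\<^sup>2) \<le> C * (\<Sum>e\<in>edges (torus_graph S T n). edge_energy f e)"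
      unfolding C_def using that
      by (intro torus_spectral_gap assms K rows c cheeger) auto
    then show "c / (2 * C) * (\<Sum>u\<in>torus_verts n. (cmod (f u))\<^sup>2) \<le> (\<Sum>e\<in>edges (torus_graph S T n). edge_energy f e)"
      using C by (simp add: field_simps)
  qed
  moreover have "c / (2 * C) > 0" using c C by simp
  moreover have "is_ugraph (torus_graph S T n) \<and> finite (verts (torus_graph S T n))" if "n \<ge> 2" for n
    using is_ugraph_torus_graph [of n S T] that by (simp add: torus_graph_def)
  moreover have "degrees_bounded_by 8 (torus_graph S T n)" if "n \<ge> 2" for n
    using degrees_torus_graph [OF _ assms(1,2)] that by simp
  ultimately show ?thesis
    unfolding expander_family_def using infinite_Ici by auto
qed

end
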